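(* Let $c\in\mathbb{C}$ with $|c|=1$, let $E$ be a complex Banach space, let $I=\mathbb{R}$ or $I=[0,\infty)$, and let $f: I\to E$ be continuous. Then $f$ is semi-$c$-periodic if and only if $$\forall \varepsilon>0\ \ \exists p>0\ \ \forall m\in\mathbb{N}\ \ \forall x\in I:\quad \|f(x+mp)-c^{m}f(x)\|\le\varepsilon .$$ Furthermore, if $I=\mathbb{R}$, then the semi-$c$-periodicity of $f$ (equivalently, the condition that for every $\varepsilon>0$ there exists $p>0$ such that $\|f(x+mp)-c^{m}f(x)\|\le\varepsilon$ for all $m\in\mathbb{N}$ and all $x\in I$) is also equivalent to $$\forall \varepsilon>0\ \ \exists p>0\ \ \forall m\in-\mathbb{N}\ \ \forall x\in I:\quad \|f(x+mp)-c^{m}f(x)\|\le\varepsilon .$$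
   Context: $\mathbb{N}=\{1,2,3,\dots\}$ and $-\mathbb{N}=\{-1,-2,\dots\}$. Put $\mathbb{S}:=\mathbb{N}$ if $I=[0,\infty)$ and $\mathbb{S}:=\mathbb{Z}$ if $I=\mathbb{R}$. A continuous function $f:I\to E$ is called semi-$c$-periodic if for every $\varepsilon>0$ there exists $p>0$ such that for all $m\in\mathbb{S}$ and all $x\in I$ one has $\|f(x+mp)-c^{m}f(x)\|\le\varepsilon$. *)

theory Defs
  imports "HOL-Analysis.Analysis"
begin

text \<open>
  Complex Banach spaces: a Banach space in the sense of the library (over the reals), together
  with a scalar multiplication by complex numbers that extends the real one and for which the
  norm is absolutely homogeneous.
\<close>

class complex_banach = banach +
  fixes scaleC :: "complex \<Rightarrow> 'a \<Rightarrow> 'a" (infixr "*\<^sub>C" 75)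
  assumes scaleC_add_right: "a *\<^sub>C (x + y) = a *\<^sub>C x + a *\<^sub>C y"
    and scaleC_add_left: "(a + b) *\<^sub>C x = a *\<^sub>C x + b *\<^sub>C x"
    and scaleC_scaleC: "a *\<^sub>C (b *\<^sub>C x) = (a * b) *\<^sub>C x"
    and scaleC_of_real: "complex_of_real r *\<^sub>C x = r *\<^sub>R x"
    and norm_scaleC: "norm (a *\<^sub>C x) = cmod a * norm x"

instantiation complex :: complex_banach
begin

definition scaleC_complex :: "complex \<Rightarrow> complex \<Rightarrow> complex"
  where "scaleC_complex a x = a * x"

instance
  by standard (simp_all add: scaleC_complex_def algebra_simps norm_mult scaleR_conv_of_real)

end

text \<open>
  The index set \<open>\<S>\<close>. It is only meant for the two intervals \<open>I = \<real>\<close> and \<open>I = [0,\<infinity>)\<close>, so that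
  the second branch below stands for the latter; the positive integers start at 1.
\<close>

definition index_set :: "real set \<Rightarrow> int set"
  where "index_set I = (if I = UNIV then UNIV else {1..})"

text \<open>
  A function \<open>I \<rightarrow> E\<close> is represented by a total function on the reals whose values outside \<open>I\<close>
  are irrelevant: for \<open>m \<in> index_set I\<close> and \<open>p > 0\<close> the point \<open>x + m p\<close> lies in \<open>I\<close> again.
\<close>

definition semi_c_periodic :: "complex \<Rightarrow> real set \<Rightarrow> (real \<Rightarrow> 'a::complex_banach) \<Rightarrow> bool"
  where "semi_c_periodic c I f \<longleftrightarrow>
    continuous_on I f \<and>
    (\<forall>\<epsilon>>0. \<exists>p>0. \<forall>m\<in>index_set I. \<forall>x\<in>I.
       norm (f (x + of_int m * p) - (c powi m) *\<^sub>C f x) \<le> \<epsilon>)"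

end

theory Submission
  imports Defs
begin

text \<open>
  Since \<open>c\<close> is unimodular, multiplication by \<open>c powi (-m)\<close> is an isometry of \<open>E\<close>. On the whole
  line, the estimate for \<open>m\<close> at the point \<open>x - m p\<close> therefore says exactly the same as the
  estimate for \<open>-m\<close> at the point \<open>x\<close>. Hence, for one and the same \<open>p\<close>, the estimates over all
  positive \<open>m\<close> and over all negative \<open>m\<close> are equivalent, and the estimate for \<open>m = 0\<close> is
  trivial. So all three conditions agree with the same choice of \<open>p\<close> for each \<open>\<epsilon>\<close>.
  On the half-line the index set consists of the positive integers, and only a change between
  natural and integer exponents is involved.
\<close>

lemma scaleC_one: "1 *\<^sub>C x = (x :: 'a::complex_banach)"
  using scaleC_of_real[of 1 x] by simp

lemma scaleC_diff_right: "a *\<^sub>C (x - y) = a *\<^sub>C x - a *\<^sub>C (y :: 'a::complex_banach)"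
  using scaleC_add_right[of a "x - y" y] by (simp add: algebra_simps)

text \<open>The left-hand vector is the image of the right-hand one under the isometry \<open>-(inverse a)\<close>.\<close>

lemma norm_diff_scaleC_inverse:
  fixes x y :: "'a::complex_banach"
  assumes "cmod a = 1"
  shows "norm (y - inverse a *\<^sub>C x) = norm (x - a *\<^sub>C y)"
proof -
  have "a \<noteq> 0" using assms by auto
  then have "inverse a *\<^sub>C (x - a *\<^sub>C y) = inverse a *\<^sub>C x - y"
    by (simp add: scaleC_diff_right scaleC_scaleC scaleC_one)
  moreover have "norm (inverse a *\<^sub>C (x - a *\<^sub>C y)) = norm (x - a *\<^sub>C y)"
    using assms by (simp add: norm_scaleC norm_inverse)
  ultimately show ?thesis by (simp add: norm_minus_commute)
qed

text \<open>Substituting \<open>x - m p\<close> for \<open>x\<close> is legitimate because the estimate is over the whole line.\<close>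

lemma translation_estimate_minus:
  fixes f :: "real \<Rightarrow> 'a::complex_banach" and m :: int
  assumes "cmod c = 1"
    and "\<forall>x. norm (f (x + of_int m * p) - (c powi m) *\<^sub>C f x) \<le> e"
  shows "norm (f (x + of_int (- m) * p) - (c powi (- m)) *\<^sub>C f x) \<le> e"
proof -
  have "norm (f (x - of_int m * p) - inverse (c powi m) *\<^sub>C f x)
      = norm (f x - (c powi m) *\<^sub>C f (x - of_int m * p))"
    by (rule norm_diff_scaleC_inverse) (simp add: norm_power_int assms(1))
  also have "\<dots> \<le> e"
    using assms(2)[rule_format, of "x - of_int m * p"] by simp
  finally show ?thesis by (simp add: power_int_minus)
qed

lemma translation_estimates_all_iff_positive:
  fixes f :: "real \<Rightarrow> 'a::complex_banach"
  assumes "cmod c = 1" and "e > 0"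
  shows "(\<forall>m::int. \<forall>x. norm (f (x + of_int m * p) - (c powi m) *\<^sub>C f x) \<le> e) \<longleftrightarrow>
    (\<forall>m\<ge>1. \<forall>x. norm (f (x + of_int m * p) - (c powi m) *\<^sub>C f x) \<le> e)"
    (is "(\<forall>m x. ?P m x) \<longleftrightarrow> _")
proof (intro iffI allI)
  fix m :: int and x
  assume pos: "\<forall>m\<ge>1. \<forall>x. ?P m x"
  consider "m \<ge> 1" | "m = 0" | "- m \<ge> 1" by linarith
  then show "?P m x"
  proof cases
    case 3
    with pos have "\<forall>x. ?P (- m) x" by blast
    from translation_estimate_minus[OF assms(1) this] show ?thesis by simp
  qed (use pos \<open>e > 0\<close> in \<open>auto simp: scaleC_one\<close>)
qed blast

lemma translation_estimates_negative_iff_positive: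
  fixes f :: "real \<Rightarrow> 'a::complex_banach"
  assumes "cmod c = 1"
  shows "(\<forall>m\<le>-1. \<forall>x. norm (f (x + of_int m * p) - (c powi m) *\<^sub>C f x) \<le> e) \<longleftrightarrow>
    (\<forall>m\<ge>1. \<forall>x. norm (f (x + of_int m * p) - (c powi m) *\<^sub>C f x) \<le> e)"
    (is "(\<forall>m\<le>-1. \<forall>x. ?P m x) \<longleftrightarrow> _")
proof -
  have flip: "?P m x" if "\<forall>x. ?P (- m) x" for m x
    using translation_estimate_minus[OF assms that] by simp
  show ?thesis
  proof (intro iffI allI impI)
    fix m :: int and x
    assume "\<forall>m\<le>-1. \<forall>x. ?P m x" "m \<ge> 1"
    then show "?P m x" by (intro flip) (drule spec[of _ "- m"], simp)
  next
    fix m :: int and x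
    assume "\<forall>m\<ge>1. \<forall>x. ?P m x" "m \<le> -1"
    then show "?P m x" by (intro flip) (drule spec[of _ "- m"], simp)
  qed
qed

lemma all_nat_ge_1_iff_all_int_ge_1:
  "(\<forall>m::nat. m \<ge> 1 \<longrightarrow> P (int m)) \<longleftrightarrow> (\<forall>m\<ge>1. P m)"
proof (intro iffI allI impI)
  fix m :: int
  assume "\<forall>m::nat. m \<ge> 1 \<longrightarrow> P (int m)" "m \<ge> 1"
  then show "P m" by (auto dest: spec[of _ "nat m"])
qed simp

theorem proposition2p5:
  fixes c :: complex
    and I :: "real set"
    and f :: "real \<Rightarrow> 'a::complex_banach"
  assumes "cmod c = 1"
    and "I = UNIV \<or> I = {0..}"
    and "continuous_on I f"
  shows "(semi_c_periodic c I f \<longleftrightarrow>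
            (\<forall>\<epsilon>>0. \<exists>p>0. \<forall>m::nat. m \<ge> 1 \<longrightarrow> (\<forall>x\<in>I.
               norm (f (x + real m * p) - (c ^ m) *\<^sub>C f x) \<le> \<epsilon>)))
       \<and> (I = UNIV \<longrightarrow>
           (semi_c_periodic c I f \<longleftrightarrow>
            (\<forall>\<epsilon>>0. \<exists>p>0. \<forall>m::int. m \<le> -1 \<longrightarrow> (\<forall>x\<in>I.
               norm (f (x + of_int m * p) - (c powi m) *\<^sub>C f x) \<le> \<epsilon>))))"
proof -
  let ?P = "\<lambda>e p m. \<forall>x\<in>I. norm (f (x + of_int m * p) - (c powi m) *\<^sub>C f x) \<le> e"
  have nat: "(\<forall>m::nat. m \<ge> 1 \<longrightarrow> (\<forall>x\<in>I. norm (f (x + real m * p) - (c ^ m) *\<^sub>C f x) \<le> e))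
      \<longleftrightarrow> (\<forall>m\<ge>1. ?P e p m)" for e p
    using all_nat_ge_1_iff_all_int_ge_1[of "?P e p"] by simp
  have index: "(\<forall>m\<in>index_set I. ?P e p m) \<longleftrightarrow> (\<forall>m\<ge>1. ?P e p m)" if "e > 0" for e p
  proof (cases "I = UNIV")
    case True
    then show ?thesis
      using translation_estimates_all_iff_positive[OF assms(1) that, of f p]
      by (simp add: index_set_def)
  qed (auto simp: index_set_def)
  have semi: "semi_c_periodic c I f \<longleftrightarrow> (\<forall>e>0. \<exists>p>0. \<forall>m\<ge>1. ?P e p m)"
    using assms(3) index by (simp add: semi_c_periodic_def)
  show ?thesis
  proof (intro conjI impI)
    assume "I = UNIV"
    then have "(\<forall>m\<le>-1. ?P e p m) \<longleftrightarrow> (\<forall>m\<ge>1. ?P e p m)" for e p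
      using translation_estimates_negative_iff_positive[OF assms(1), of f p e] by simp
    then show "semi_c_periodic c I f \<longleftrightarrow> (\<forall>e>0. \<exists>p>0. \<forall>m\<le>-1. ?P e p m)"
      unfolding semi by simp
  qed (simp only: semi nat)
qed

end
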